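(* Let $p\ge1$, $m=2p$, $j=\mathrm{diag}(I_p,-I_p)$, $n>0$. Let $A$ be an $n\times n$ matrix with $\det A\neq0$, $S_0>0$ an $n\times n$ matrix, and $\Pi_0=[\Phi\ \ \Psi]$ an $n\times m$ matrix ($\Phi,\Psi$ of size $n\times p$) with $AS_0-S_0A^*=i\Pi_0j\Pi_0^*$. Define for $k\ge0$ $$\Pi_{k+1}=\Pi_k+iA^{-1}\Pi_kj,\quad S_{k+1}=S_k+A^{-1}S_k(A^* )^{-1}+A^{-1}\Pi_k\Pi_k^*(A^* )^{-1},\quad C_k=I_m+\Pi_k^*S_k^{-1}\Pi_k-\Pi_{k+1}^*S_{k+1}^{-1}\Pi_{k+1}.$$ Then the system $W_{k+1}(\lambda)-W_k(\lambda)=-\frac{i}{\lambda}jC_kW_k(\lambda)$ is well defined for all $k\ge0$, and it has a unique Weyl function (in the sense defined in the context), namely $$\varphi(\lambda)=-i\Phi^*S_0^{-1}(A^{\times}-\lambda I_n)^{-1}\Psi,\qquad A^{\times}=A+i\Psi\Psi^*S_0^{-1}.$$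
   Context: $W_k(\lambda)$ denotes the solution of the system with $W_0(\lambda)=I_m$; $\mathbb C_-$ is the open lower half-plane; $q(\lambda)=|\lambda|^2(|\lambda|^2+1)^{-1}$. For a system of this form on $k\ge0$ with $C_k>0$, $C_k=C_k^*$, $C_kjC_k=j$, a $p\times p$ matrix function $\varphi$ holomorphic in $\mathbb C_-$ is called a Weyl function if for every $\lambda\in\mathbb C_-$ $$\sum_{k=0}^\infty [\varphi(\lambda)^*\ \ I_p]\,q(\lambda)^kW_k(\lambda)^*C_kW_k(\lambda)\begin{bmatrix}\varphi(\lambda)\\ I_p\end{bmatrix}<\infty,$$ i.e. this series of positive semidefinite matrices converges. *)

theory Defs
  imports "HOL-Analysis.Analysis"
begin

text \<open>Complex matrices are type-indexed: an r x c matrix is complex^'c^'r.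
  The index type of C^m, m = 2p, is 'p::finite + 'p (first block Inl, second block Inr).\<close>

definition adj :: "complex^'c^'r \<Rightarrow> complex^'r^'c" where
  "adj M = (\<chi> i j. cnj (M $ j $ i))"

definition smul :: "complex \<Rightarrow> complex^'c^'r \<Rightarrow> complex^'c^'r" where
  "smul z M = (\<chi> i j. z * M $ i $ j)"

definition pos_def :: "complex^'n::finite^'n \<Rightarrow> bool" where
  "pos_def S \<longleftrightarrow> adj S = S \<and>
     (\<forall>x::complex^'n. x \<noteq> 0 \<longrightarrow> 0 < Re (\<Sum>i\<in>UNIV. cnj (x $ i) * (S *v x) $ i))"

definition jmat :: "complex^('p::finite + 'p)^('p::finite + 'p)" where
  "jmat = (\<chi> a b. if a = b then (case a of Inl _ \<Rightarrow> 1 | Inr _ \<Rightarrow> -1) else 0)"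

definition hblock :: "complex^'p::finite^'n::finite \<Rightarrow> complex^'p::finite^'n::finite \<Rightarrow> complex^('p::finite + 'p)^'n" where
  "hblock Phi Psi = (\<chi> i b. case b of Inl a \<Rightarrow> Phi $ i $ a | Inr a \<Rightarrow> Psi $ i $ a)"

definition vblock_id :: "complex^'p::finite^'p \<Rightarrow> complex^'p^('p::finite + 'p)" where
  "vblock_id F = (\<chi> b c. case b of Inl a \<Rightarrow> F $ a $ c | Inr a \<Rightarrow> (if a = c then 1 else 0))"

primrec PiSeq :: "complex^'n::finite^'n \<Rightarrow> complex^('p::finite + 'p)^'n \<Rightarrow> nat \<Rightarrow> complex^('p::finite + 'p)^'n" where
  "PiSeq A Pi0 0 = Pi0"
| "PiSeq A Pi0 (Suc k) = PiSeq A Pi0 k + smul \<i> (matrix_inv A ** PiSeq A Pi0 k ** jmat)"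

primrec SSeq :: "complex^'n::finite^'n \<Rightarrow> complex^'n::finite^'n \<Rightarrow> complex^('p::finite + 'p)^'n \<Rightarrow> nat \<Rightarrow> complex^'n::finite^'n" where
  "SSeq A S0 Pi0 0 = S0"
| "SSeq A S0 Pi0 (Suc k) = SSeq A S0 Pi0 k
     + matrix_inv A ** SSeq A S0 Pi0 k ** matrix_inv (adj A)
     + matrix_inv A ** PiSeq A Pi0 k ** adj (PiSeq A Pi0 k) ** matrix_inv (adj A)"

definition CSeq :: "complex^'n::finite^'n \<Rightarrow> complex^'n::finite^'n \<Rightarrow> complex^('p::finite + 'p)^'n \<Rightarrow> nat
    \<Rightarrow> complex^('p::finite + 'p)^('p::finite + 'p)" where
  "CSeq A S0 Pi0 k = mat 1
     + adj (PiSeq A Pi0 k) ** matrix_inv (SSeq A S0 Pi0 k) ** PiSeq A Pi0 k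
     - adj (PiSeq A Pi0 (Suc k)) ** matrix_inv (SSeq A S0 Pi0 (Suc k)) ** PiSeq A Pi0 (Suc k)"

primrec Wsol :: "(nat \<Rightarrow> complex^('p::finite + 'p)^('p::finite + 'p)) \<Rightarrow> complex \<Rightarrow> nat \<Rightarrow> complex^('p::finite + 'p)^('p::finite + 'p)" where
  "Wsol C z 0 = mat 1"
| "Wsol C z (Suc k) = Wsol C z k - smul (\<i> / z) (jmat ** C k ** Wsol C z k)"

definition qfun :: "complex \<Rightarrow> real" where
  "qfun z = (cmod z)^2 / ((cmod z)^2 + 1)"

definition lower_half :: "complex set" where
  "lower_half = {z. Im z < 0}"

definition is_weyl_function :: "(nat \<Rightarrow> complex^('p::finite + 'p)^('p::finite + 'p)) \<Rightarrow> (complex \<Rightarrow> complex^'p::finite^'p) \<Rightarrow> bool" where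
  "is_weyl_function C \<phi> \<longleftrightarrow>
     (\<forall>a b. (\<lambda>z. \<phi> z $ a $ b) holomorphic_on lower_half) \<and>
     (\<forall>z\<in>lower_half. summable (\<lambda>k.
        adj (vblock_id (\<phi> z)) ** (qfun z ^ k *\<^sub>R (adj (Wsol C z k) ** C k ** Wsol C z k))
          ** vblock_id (\<phi> z)))"

end

theory Submission
  imports Defs
begin

text \<open>
  One step \<open>(\<Pi>, S) \<mapsto> (\<Pi>', S')\<close> of the recursion preserves \<open>AS - SA\<^sup>* = i\<Pi>j\<Pi>\<^sup>*\<close> and
  \<open>S > 0\<close>; this yields \<open>CjC = j\<close> by algebra and \<open>C > 0\<close> by completing squares.

  For any system with \<open>C\<^sub>k > 0\<close> and \<open>C\<^sub>kjC\<^sub>k = j\<close>, the identity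
  \<open>q W\<^sub>k\<^sub>+\<^sub>1\<^sup>*jW\<^sub>k\<^sub>+\<^sub>1 = W\<^sub>k\<^sup>*jW\<^sub>k + \<kappa> W\<^sub>k\<^sup>*C\<^sub>kW\<^sub>k\<close> with \<open>\<kappa> = -2 Im z / (|z|\<^sup>2 + 1) > 0\<close>
  telescopes. Hence the Weyl series converges on a vector \<open>v\<close> as soon as the \<open>j\<close>-form stays bounded
  along the solution, and, as \<open>C\<^sub>k \<ge> j\<close>, only if \<open>v\<^sup>*jv \<le> 0\<close>. The latter fails for \<open>v = (f, 0)\<close> with
  \<open>f \<noteq> 0\<close>, and the difference of two Weyl functions would produce such vectors.

  The solution starting at \<open>(\<phi>(z)u, u)\<close> is a multiple of \<open>e - i j \<Pi>\<^sub>k\<^sup>* S\<^sub>k\<^sup>-\<^sup>1 x\<^sub>k\<close> with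
  \<open>e = (0, d)\<close> and \<open>(A - z) x\<^sub>k = \<Pi>\<^sub>k e\<close>, whose \<open>j\<close>-form is
  \<open>-d\<^sup>*d + 2 Im z x\<^sub>k\<^sup>*S\<^sub>k\<^sup>-\<^sup>1x\<^sub>k \<le> 0\<close>. Starting from \<open>x\<^sub>0 = (A\<^sup>\<times> - z)\<^sup>-\<^sup>1\<Psi>u\<close> instead of a
  resolvent of \<open>A\<close> covers the eigenvalues of \<open>A\<close> in the lower half-plane as well.
\<close>

section \<open>Complex matrices\<close>

lemma smul_mult_vec: "smul c M *v x = c *s (M *v x)"
  by (simp add: vec_eq_iff matrix_vector_mult_def smul_def sum_distrib_left algebra_simps)

lemma scaleR_mult_vec: "(r *\<^sub>R M) *v x = r *\<^sub>R (M *v x)" for M :: "complex^'c^'r"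
  by (simp add: vec_eq_iff matrix_vector_mult_def scaleR_sum_right)

lemmas matrix_vector_simps = matrix_vector_mul_assoc[symmetric] matrix_vector_right_distrib
  matrix_vector_mult_add_rdistrib matrix_vector_mult_diff_distrib
  matrix_vector_mult_diff_rdistrib vector_scalar_commute smul_mult_vec

lemma adj_adj [simp]: "adj (adj M) = M"
  by (simp add: adj_def vec_eq_iff)

lemma adj_mult: "adj (M ** N) = adj N ** adj M"
  by (simp add: adj_def vec_eq_iff matrix_matrix_mult_def mult.commute)

lemma adj_add: "adj (M + N) = adj M + adj N"
  by (simp add: adj_def vec_eq_iff)

lemma adj_diff: "adj (M - N) = adj M - adj N"
  by (simp add: adj_def vec_eq_iff)

lemma adj_smul: "adj (smul c M) = smul (cnj c) (adj M)"
  by (simp add: adj_def smul_def vec_eq_iff)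

lemma adj_scaleR: "adj (r *\<^sub>R M) = r *\<^sub>R adj M"
  by (simp add: adj_def vec_eq_iff)

lemma adj_mat_1 [simp]: "adj (mat 1) = mat 1"
  by (simp add: adj_def mat_def vec_eq_iff)

lemma matrix_inv_mult:
  fixes M :: "'a::semiring_1^'n^'m"
  assumes "invertible M"
  shows matrix_inv_right: "M ** matrix_inv M = mat 1"
    and matrix_inv_left: "matrix_inv M ** M = mat 1"
  using someI_ex[OF assms[unfolded invertible_def]] by (simp_all add: matrix_inv_def)

lemma matrix_inv_unique:
  fixes M :: "'a::semiring_1^'n^'m"
  assumes "M ** N = mat 1" "N ** M = mat 1"
  shows "matrix_inv M = N"
proof -
  have "invertible M" using assms by (auto simp: invertible_def)
  then have "matrix_inv M ** (M ** N) = N"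
    by (simp add: matrix_mul_assoc matrix_inv_left)
  then show ?thesis by (simp add: assms(1))
qed

lemma matrix_inv_mult_vec:
  fixes M :: "'a::semiring_1^'n^'m"
  assumes "invertible M"
  shows "M *v (matrix_inv M *v x) = x" "matrix_inv M *v (M *v y) = y"
  using assms by (simp_all add: matrix_vector_mul_assoc matrix_inv_mult)

lemma adj_matrix_inv:
  assumes "invertible M"
  shows "matrix_inv (adj M) = adj (matrix_inv M)"
  using assms by (intro matrix_inv_unique) (simp_all add: adj_mult[symmetric] matrix_inv_mult)

lemma invertibleI_ker:
  fixes M :: "'a::field^'n^'n"
  assumes "\<And>x. M *v x = 0 \<Longrightarrow> x = 0"
  shows "invertible M"
  using assms invertible_left_inverse matrix_left_invertible_ker by blast

section \<open>Hermitian forms\<close>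

lemma inner_complex_vec: "x \<bullet> y = Re (\<Sum>i\<in>UNIV. cnj (x $ i) * y $ i)" for x y :: "complex^'n"
  by (simp add: inner_vec_def inner_complex_def)

lemma inner_mult_vec_left: "(M *v x) \<bullet> y = x \<bullet> (adj M *v y)" for M :: "complex^'c^'r"
proof -
  have "(\<Sum>i\<in>UNIV. cnj ((M *v x) $ i) * y $ i) = (\<Sum>i\<in>UNIV. cnj (x $ i) * (adj M *v y) $ i)"
    unfolding matrix_vector_mult_def adj_def
    by (simp add: sum_distrib_left sum_distrib_right) (subst sum.swap, simp add: algebra_simps)
  then show ?thesis by (simp only: inner_complex_vec)
qed

lemma inner_smult_left: "(c *s x) \<bullet> y = x \<bullet> (cnj c *s y)" for x y :: "complex^'n"
  by (simp add: inner_complex_vec algebra_simps)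

lemma inner_ii_smult_right: "x \<bullet> (\<i> *s y) = - ((\<i> *s x) \<bullet> y)" for x y :: "complex^'n"
  by (simp add: inner_smult_left)

text \<open>
  The real inner product of \<open>complex^'n\<close> is the real part of the Hermitian one, so
  \<open>quad_form M x\<close> is \<open>x\<^sup>*Mx\<close> only for Hermitian \<open>M\<close>.
\<close>

definition quad_form :: "complex^'n^'n \<Rightarrow> complex^'n \<Rightarrow> real" where
  "quad_form M x = x \<bullet> (M *v x)"

lemma quad_form_add:
  assumes "adj M = M"
  shows "quad_form M (x + y) = quad_form M x + 2 * (x \<bullet> (M *v y)) + quad_form M y"
  using inner_mult_vec_left[of M x y] assms
  by (simp add: quad_form_def matrix_vector_right_distrib inner_simps inner_commute)

lemma quad_form_diff:
  assumes "adj M = M"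
  shows "quad_form M (x - y) = quad_form M x - 2 * (x \<bullet> (M *v y)) + quad_form M y"
  using inner_mult_vec_left[of M x y] assms
  by (simp add: quad_form_def matrix_vector_mult_diff_distrib inner_simps inner_commute)

lemma quad_form_smult: "quad_form M (c *s x) = (cmod c)\<^sup>2 * quad_form M x"
proof -
  have "quad_form M (c *s x) = x \<bullet> ((cnj c * c) *s (M *v x))"
    by (simp add: quad_form_def vector_scalar_commute inner_smult_left vector_smult_assoc)
  also have "(cnj c * c) *s (M *v x) = (cmod c)\<^sup>2 *\<^sub>R (M *v x)"
    by (simp add: vec_eq_iff scaleR_conv_of_real[where 'a=complex] mult.commute
        flip: complex_norm_square)
  finally show ?thesis by (simp add: quad_form_def)
qed

lemma quad_form_scaleR_matrix: "quad_form (r *\<^sub>R M) x = r * quad_form M x"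
  by (simp add: quad_form_def scaleR_mult_vec)

lemma quad_form_congruence: "quad_form (adj X ** M ** X) x = quad_form M (X *v x)"
  by (simp add: quad_form_def inner_mult_vec_left flip: matrix_vector_mul_assoc)

lemma inner_smult_hermitian:
  assumes "adj M = M"
  shows "x \<bullet> (c *s (M *v x)) = Re c * quad_form M x"
proof -
  have "x \<bullet> (\<i> *s (M *v x)) = - (x \<bullet> (\<i> *s (M *v x)))"
    using inner_mult_vec_left[of M x "\<i> *s x"] inner_ii_smult_right[of "M *v x" x]
    by (simp add: assms vector_scalar_commute inner_commute)
  moreover have "c *s (M *v x) = Re c *\<^sub>R (M *v x) + Im c *\<^sub>R (\<i> *s (M *v x))"
    by (simp add: vec_eq_iff complex_eq_iff)
  ultimately show ?thesis by (simp add: inner_simps quad_form_def)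
qed

lemma pos_def_iff: "pos_def S \<longleftrightarrow> adj S = S \<and> (\<forall>x. x \<noteq> 0 \<longrightarrow> 0 < quad_form S x)"
  by (simp add: pos_def_def inner_complex_vec quad_form_def)

lemma pos_def_adj: "pos_def S \<Longrightarrow> adj S = S"
  by (simp add: pos_def_iff)

lemma quad_form_pos: "pos_def S \<Longrightarrow> x \<noteq> 0 \<Longrightarrow> 0 < quad_form S x"
  by (simp add: pos_def_iff)

lemma quad_form_nonneg: "pos_def S \<Longrightarrow> 0 \<le> quad_form S x"
  by (cases "x = 0") (auto simp: pos_def_iff quad_form_def less_imp_le)

lemma pos_def_invertible:
  assumes "pos_def S"
  shows "invertible S"
proof (rule invertibleI_ker)
  show "x = 0" if "S *v x = 0" for x
    using quad_form_pos[OF assms, of x] that by (auto simp: quad_form_def)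
qed

lemma pos_def_matrix_inv:
  assumes "pos_def S"
  shows "pos_def (matrix_inv S)"
  unfolding pos_def_iff
proof (intro conjI allI impI)
  note invertible = pos_def_invertible[OF assms]
  show "adj (matrix_inv S) = matrix_inv S"
    using adj_matrix_inv[OF invertible] pos_def_adj[OF assms] by simp
  fix x :: "complex^'a" assume "x \<noteq> 0"
  then have "matrix_inv S *v x \<noteq> 0"
    by (metis matrix_inv_mult_vec(1)[OF invertible] matrix_vector_mult_0_right)
  then show "0 < quad_form (matrix_inv S) x"
    using quad_form_pos[OF assms]
    by (force simp: quad_form_def matrix_inv_mult_vec[OF invertible] inner_commute)
qed

lemma quad_form_parallelogram_le:
  assumes "pos_def M"
  shows "quad_form M (x - y) \<le> 2 * quad_form M x + 2 * quad_form M y"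
  using quad_form_nonneg[OF assms, of "x + y"] pos_def_adj[OF assms]
  by (simp add: quad_form_add quad_form_diff)

section \<open>Series and holomorphic families of matrices\<close>

lemma summable_vecI:
  fixes f :: "nat \<Rightarrow> 'a::real_normed_vector^'n"
  assumes "\<And>i. summable (\<lambda>k. f k $ i)"
  shows "summable f"
proof -
  have "f sums (\<chi> i. \<Sum>k. f k $ i)"
    unfolding sums_def using assms by (intro vec_tendstoI) (simp add: summable_LIMSEQ)
  then show ?thesis by (rule sums_summable)
qed

lemma matrix_entry_eq_inner:
  fixes M :: "complex^'c^'r"
  shows "M $ a $ b = Complex (axis a 1 \<bullet> (M *v axis b 1)) (axis a \<i> \<bullet> (M *v axis b 1))"
proof -
  have "(M *v axis b 1) $ a = M $ a $ b"
    by (simp add: matrix_vector_mult_def axis_def if_distrib cong: if_cong)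
  then show ?thesis by (simp add: complex_eq_iff inner_axis')
qed

lemma summable_hermitian_iff:
  fixes M :: "nat \<Rightarrow> complex^'n^'n"
  assumes hermitian: "\<And>k. adj (M k) = M k"
  shows "summable M \<longleftrightarrow> (\<forall>x. summable (\<lambda>k. quad_form (M k) x))"
proof (intro iffI allI)
  fix x :: "complex^'n" assume "summable M"
  have "linear (\<lambda>N. quad_form N x)"
    by (rule linearI)
      (simp_all add: quad_form_def matrix_vector_mult_add_rdistrib scaleR_mult_vec inner_simps)
  then show "summable (\<lambda>k. quad_form (M k) x)"
    using bounded_linear.summable[OF _ \<open>summable M\<close>] by (simp add: linear_conv_bounded_linear)
next
  assume form: "\<forall>x. summable (\<lambda>k. quad_form (M k) x)"
  have "x \<bullet> (M k *v y) = (quad_form (M k) (x + y) - quad_form (M k) x - quad_form (M k) y) / 2"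
    for x y k
    by (simp add: quad_form_add hermitian)
  then have "summable (\<lambda>k. x \<bullet> (M k *v y))" for x y
    using form by (simp only: summable_divide summable_diff)
  then show "summable M"
    by (intro summable_vecI) (subst matrix_entry_eq_inner, simp add: summable_complex_iff)
qed

lemma holomorphic_on_det:
  fixes F :: "complex \<Rightarrow> complex^'n^'n"
  assumes "\<And>i j. (\<lambda>z. F z $ i $ j) holomorphic_on U"
  shows "(\<lambda>z. det (F z)) holomorphic_on U"
  unfolding det_def by (intro holomorphic_intros assms)

lemma holomorphic_on_matrix_mult:
  fixes F :: "complex \<Rightarrow> complex^'b^'a" and G :: "complex \<Rightarrow> complex^'c^'b"
  assumes "\<And>i j. (\<lambda>z. F z $ i $ j) holomorphic_on U" "\<And>i j. (\<lambda>z. G z $ i $ j) holomorphic_on U"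
  shows "(\<lambda>z. (F z ** G z) $ i $ j) holomorphic_on U"
  unfolding matrix_matrix_mult_def by (simp, intro holomorphic_intros assms)

lemma matrix_inv_entry_cramer:
  fixes M :: "'a::field^'n^'n"
  assumes "invertible M"
  shows "matrix_inv M $ i $ j = det (\<chi> a b. if b = i then axis j 1 $ a else M $ a $ b) / det M"
proof -
  have "matrix_inv M *v axis j 1
      = (\<chi> k. det (\<chi> a b. if b = k then axis j 1 $ a else M $ a $ b) / det M)"
    using cramer matrix_inv_mult_vec(1)[OF assms] assms invertible_det_nz by blast
  moreover have "(matrix_inv M *v axis j 1) $ i = matrix_inv M $ i $ j"
    by (simp add: matrix_vector_mult_def axis_def if_distrib cong: if_cong)
  ultimately show ?thesis by simp
qed

lemma holomorphic_on_matrix_inv: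
  fixes F :: "complex \<Rightarrow> complex^'n^'n"
  assumes holomorphic: "\<And>i j. (\<lambda>z. F z $ i $ j) holomorphic_on U"
    and invertible: "\<And>z. z \<in> U \<Longrightarrow> invertible (F z)"
  shows "(\<lambda>z. matrix_inv (F z) $ i $ j) holomorphic_on U"
proof -
  let ?G = "\<lambda>z. \<chi> a b. if b = i then axis j 1 $ a else F z $ a $ b"
  have "(\<lambda>z. ?G z $ a $ b) holomorphic_on U" for a b
    by (cases "b = i") (simp_all add: holomorphic)
  then have "(\<lambda>z. det (?G z) / det (F z)) holomorphic_on U"
    using invertible
    by (intro holomorphic_on_divide holomorphic_on_det holomorphic) (auto simp: invertible_det_nz)
  then show ?thesis
    by (simp add: invertible matrix_inv_entry_cramer cong: holomorphic_cong)
qed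

section \<open>Block vectors\<close>

definition vpair :: "complex^'p::finite \<Rightarrow> complex^'p \<Rightarrow> complex^('p + 'p)" where
  "vpair x y = (\<chi> b. case b of Inl a \<Rightarrow> x $ a | Inr a \<Rightarrow> y $ a)"

lemma sum_UNIV_Plus:
  "sum f (UNIV :: ('a::finite + 'b::finite) set) = (\<Sum>a\<in>UNIV. f (Inl a)) + (\<Sum>b\<in>UNIV. f (Inr b))"
  by (simp add: sum.Plus flip: UNIV_Plus_UNIV)

lemma vec_eq_iff_Plus: "v = w \<longleftrightarrow> (\<forall>a. v $ Inl a = w $ Inl a) \<and> (\<forall>b. v $ Inr b = w $ Inr b)"
  for v w :: "'c^('a::finite+'b::finite)"
  by (metis sum.exhaust vec_eq_iff)

lemma vpair_nth [simp]: "vpair x y $ Inl a = x $ a" "vpair x y $ Inr a = y $ a"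
  by (simp_all add: vpair_def)

lemma vpair_cases: obtains x y where "v = vpair x y"
  by (rule that[of "\<chi> a. v $ Inl a" "\<chi> a. v $ Inr a"]) (simp add: vec_eq_iff_Plus)

lemma vpair_diff: "vpair a b - vpair c d = vpair (a - c) (b - d)"
  by (simp add: vec_eq_iff_Plus)

lemma inner_vpair: "vpair a b \<bullet> vpair c d = a \<bullet> c + b \<bullet> d"
  by (simp add: inner_vec_def sum_UNIV_Plus)

lemma hblock_mult_vpair: "hblock P Q *v vpair x y = P *v x + Q *v y"
  by (simp add: vec_eq_iff matrix_vector_mult_def sum_UNIV_Plus hblock_def)

lemma adj_hblock_mult_vec: "adj (hblock P Q) *v y = vpair (adj P *v y) (adj Q *v y)"
  by (simp add: vec_eq_iff_Plus matrix_vector_mult_def hblock_def adj_def)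

lemma vblock_id_mult_vec: "vblock_id F *v u = vpair (F *v u) u"
  by (simp add: vec_eq_iff_Plus matrix_vector_mult_def vblock_id_def if_distrib[of "\<lambda>c. c * _"]
      cong: if_cong)

lemma jmat_mult_vpair: "jmat *v vpair x y = vpair x (- y)"
  by (simp add: vec_eq_iff_Plus matrix_vector_mult_def sum_UNIV_Plus jmat_def
      if_distrib[of "\<lambda>c. c * _"] cong: if_cong)

lemma quad_form_jmat_vpair: "quad_form jmat (vpair x y) = x \<bullet> x - y \<bullet> y"
  by (simp add: quad_form_def jmat_mult_vpair inner_vpair)

section \<open>Signature matrices\<close>

locale signature_matrix =
  fixes J :: "complex^'m^'m"
  assumes adj_J: "adj J = J" and J_J: "J ** J = mat 1"
begin

lemma J_J_mult_vec [simp]: "J *v (J *v v) = v"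
  by (simp add: matrix_vector_mul_assoc J_J)

lemma inner_J: "(J *v v) \<bullet> w = v \<bullet> (J *v w)"
  by (simp add: inner_mult_vec_left adj_J)

lemma J_mult_vec_eq_0_iff: "J *v v = 0 \<longleftrightarrow> v = 0"
  by (metis J_J_mult_vec matrix_vector_mult_0_right)

lemma C_J_C_mult_vec:
  assumes "C ** J ** C = J"
  shows "C *v (J *v (C *v v)) = J *v v"
  using assms by (simp add: matrix_vector_mul_assoc matrix_mul_assoc)

lemma quad_form_J_step:
  assumes adj_C: "adj C = C" and C_J_C: "C ** J ** C = J"
  shows "quad_form J (v - c *s (J *v (C *v v)))
    = (1 + (cmod c)\<^sup>2) * quad_form J v - 2 * Re c * quad_form C v"
proof -
  have "quad_form J (J *v (C *v v)) = quad_form J v"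
    using inner_mult_vec_left[of C v "J *v (C *v v)"]
    by (simp add: quad_form_def adj_C C_J_C_mult_vec[OF C_J_C] inner_commute)
  then show ?thesis
    using inner_smult_hermitian[OF adj_C, of v c]
    by (simp add: quad_form_diff adj_J quad_form_smult vector_scalar_commute algebra_simps)
qed

lemma quad_form_J_le:
  assumes C_pos: "pos_def C" and C_J_C: "C ** J ** C = J"
  shows "quad_form J v \<le> quad_form C v"
proof -
  have "quad_form C (J *v (C *v v)) = quad_form C v"
    by (simp add: quad_form_def C_J_C_mult_vec[OF C_J_C] inner_J inner_commute)
  moreover have "0 \<le> quad_form C (v - J *v (C *v v))"
    by (rule quad_form_nonneg[OF C_pos])
  ultimately show ?thesis
    by (simp add: quad_form_diff pos_def_adj[OF C_pos] C_J_C_mult_vec[OF C_J_C] quad_form_def[of J])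
qed

end

interpretation jmat: signature_matrix jmat
proof
  show "adj jmat = jmat"
    by (auto simp: adj_def jmat_def vec_eq_iff split: sum.split)
  show "jmat ** jmat = mat 1"
    unfolding matrix_eq
  proof
    show "jmat ** jmat *v v = mat 1 *v v" for v
      by (rule vpair_cases[of v]) (simp add: jmat_mult_vpair flip: matrix_vector_mul_assoc)
  qed
qed

section \<open>Weyl functions of discrete Dirac systems\<close>

lemma qfun_nonneg: "0 \<le> qfun z"
  by (simp add: qfun_def)

lemma
  assumes "z \<noteq> 0"
  shows qfun_mult_one_plus: "qfun z * (1 + 1 / (cmod z)\<^sup>2) = 1"
    and qfun_divide: "qfun z / (cmod z)\<^sup>2 = 1 / ((cmod z)\<^sup>2 + 1)"
proof -
  have "(cmod z)\<^sup>2 + 1 \<noteq> 0"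
    using sum_power2_gt_zero_iff[of "cmod z" 1] by simp
  moreover from assms have "1 + 1 / (cmod z)\<^sup>2 = ((cmod z)\<^sup>2 + 1) / (cmod z)\<^sup>2"
    by (simp add: field_simps)
  ultimately show "qfun z * (1 + 1 / (cmod z)\<^sup>2) = 1"
    and "qfun z / (cmod z)\<^sup>2 = 1 / ((cmod z)\<^sup>2 + 1)"
    using assms by (simp_all add: qfun_def)
qed

locale dirac_system =
  fixes C :: "nat \<Rightarrow> complex^('p::finite + 'p)^('p + 'p)"
  assumes C_pos: "pos_def (C k)" and C_jmat_C: "C k ** jmat ** C k = jmat"
begin

definition energy :: "complex \<Rightarrow> complex^('p + 'p) \<Rightarrow> nat \<Rightarrow> real" where
  "energy z v k = qfun z ^ k * quad_form (C k) (Wsol C z k *v v)"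

definition j_energy :: "complex \<Rightarrow> complex^('p + 'p) \<Rightarrow> nat \<Rightarrow> real" where
  "j_energy z v k = qfun z ^ k * quad_form jmat (Wsol C z k *v v)"

lemma energy_nonneg: "0 \<le> energy z v k"
  unfolding energy_def using qfun_nonneg quad_form_nonneg[OF C_pos] by simp

lemma j_energy_le_energy: "j_energy z v k \<le> energy z v k"
  unfolding energy_def j_energy_def
  using jmat.quad_form_J_le[OF C_pos C_jmat_C] qfun_nonneg by (simp add: mult_left_mono)

lemma j_energy_Suc:
  assumes "z \<noteq> 0"
  shows "j_energy z v (Suc k) = j_energy z v k - 2 * Im z / ((cmod z)\<^sup>2 + 1) * energy z v k"
proof -
  let ?w = "Wsol C z k *v v"
  have "Wsol C z (Suc k) *v v = ?w - (\<i> / z) *s (jmat *v (C k *v ?w))"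
    by (simp add: matrix_vector_simps)
  moreover have "(cmod (\<i> / z))\<^sup>2 = 1 / (cmod z)\<^sup>2" "Re (\<i> / z) = Im z / (cmod z)\<^sup>2"
    by (simp_all add: norm_divide power_divide Re_divide cmod_power2)
  ultimately have step: "quad_form jmat (Wsol C z (Suc k) *v v)
      = (1 + 1 / (cmod z)\<^sup>2) * quad_form jmat ?w - 2 * (Im z / (cmod z)\<^sup>2) * quad_form (C k) ?w"
    using jmat.quad_form_J_step[OF pos_def_adj[OF C_pos] C_jmat_C] by simp
  have "j_energy z v (Suc k) = qfun z * (1 + 1 / (cmod z)\<^sup>2) * j_energy z v k
      - qfun z / (cmod z)\<^sup>2 * (2 * Im z) * energy z v k"
    unfolding j_energy_def energy_def power_Suc step by (simp add: algebra_simps)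
  then show ?thesis by (simp add: qfun_mult_one_plus[OF assms] qfun_divide[OF assms])
qed

lemma incseq_j_energy:
  assumes "Im z < 0"
  shows "incseq (j_energy z v)"
proof (rule incseq_SucI)
  fix k
  have "z \<noteq> 0" using assms by auto
  moreover have "2 * Im z / ((cmod z)\<^sup>2 + 1) * energy z v k \<le> 0"
    using assms by (intro mult_nonpos_nonneg[OF divide_nonpos_nonneg energy_nonneg]) auto
  ultimately show "j_energy z v k \<le> j_energy z v (Suc k)"
    by (simp add: j_energy_Suc)
qed

lemma summable_energy_if_bounded:
  assumes Im_z_neg: "Im z < 0" and bound: "\<And>k. j_energy z v k \<le> b"
  shows "summable (energy z v)"
proof -
  define \<kappa> where "\<kappa> = - (2 * Im z) / ((cmod z)\<^sup>2 + 1)"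
  have "0 < \<kappa>" using Im_z_neg unfolding \<kappa>_def by (intro divide_pos_pos add_nonneg_pos) auto
  have "z \<noteq> 0" using Im_z_neg by auto
  have "\<kappa> * (\<Sum>k<N. energy z v k) = j_energy z v N - j_energy z v 0" for N
    by (induction N) (simp_all add: j_energy_Suc[OF \<open>z \<noteq> 0\<close>] \<kappa>_def distrib_left)
  then have "(\<Sum>k<N. energy z v k) \<le> (b - j_energy z v 0) / \<kappa>" for N
    using bound[of N] \<open>0 < \<kappa>\<close> by (simp add: pos_le_divide_eq mult.commute)
  with energy_nonneg show ?thesis by (rule summableI_nonneg_bounded)
qed

lemma quad_form_jmat_nonpos_if_summable:
  assumes Im_z_neg: "Im z < 0" and summable: "summable (energy z v)"
  shows "quad_form jmat v \<le> 0"
proof (rule LIMSEQ_le_const)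
  show "energy z v \<longlonglongrightarrow> 0" by (rule summable_LIMSEQ_zero[OF summable])
  have "j_energy z v 0 \<le> energy z v k" for k
    using incseqD[OF incseq_j_energy[OF Im_z_neg]] j_energy_le_energy order_trans by blast
  then show "\<exists>N. \<forall>k\<ge>N. quad_form jmat v \<le> energy z v k"
    by (simp add: j_energy_def)
qed

lemma summable_energy_diff:
  assumes "summable (energy z v)" "summable (energy z w)"
  shows "summable (energy z (v - w))"
proof (rule summable_comparison_test')
  show "summable (\<lambda>k. 2 * energy z v k + 2 * energy z w k)"
    by (intro summable_add summable_mult assms)
  have "energy z (v - w) k \<le> 2 * energy z v k + 2 * energy z w k" for k
    using mult_left_mono[OF quad_form_parallelogram_le[OF C_pos], of "qfun z ^ k"]
    by (simp add: energy_def matrix_vector_mult_diff_distrib qfun_nonneg distrib_left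
        mult.left_commute)
  then show "norm (energy z (v - w) k) \<le> 2 * energy z v k + 2 * energy z w k" if "k \<ge> 0" for k
    by (simp add: energy_nonneg)
qed

lemma weyl_matrix_unique:
  assumes Im_z_neg: "Im z < 0"
    and F_summable: "\<And>u. summable (energy z (vblock_id F *v u))"
    and G_summable: "\<And>u. summable (energy z (vblock_id G *v u))"
  shows "F = G"
  unfolding matrix_eq
proof
  fix u
  have "vblock_id F *v u - vblock_id G *v u = vpair (F *v u - G *v u) 0"
    by (simp add: vblock_id_mult_vec vpair_diff)
  then have "quad_form jmat (vpair (F *v u - G *v u) 0) \<le> 0"
    using quad_form_jmat_nonpos_if_summable[OF Im_z_neg summable_energy_diff[OF F_summable G_summable]]
    by metis
  then have "(F *v u - G *v u) \<bullet> (F *v u - G *v u) \<le> 0"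
    by (simp add: quad_form_jmat_vpair)
  then show "F *v u = G *v u" by (metis eq_iff_diff_eq_0 inner_gt_zero_iff not_less)
qed

lemma summable_weyl_series_iff:
  "summable (\<lambda>k. adj (vblock_id F) ** (qfun z ^ k *\<^sub>R (adj (Wsol C z k) ** C k ** Wsol C z k))
      ** vblock_id F) \<longleftrightarrow> (\<forall>u. summable (energy z (vblock_id F *v u)))"
  by (subst summable_hermitian_iff)
    (simp_all add: adj_mult adj_scaleR pos_def_adj[OF C_pos] matrix_mul_assoc
      quad_form_congruence quad_form_scaleR_matrix energy_def[abs_def])

lemma is_weyl_function_iff:
  "is_weyl_function C \<phi> \<longleftrightarrow> (\<forall>a b. (\<lambda>z. \<phi> z $ a $ b) holomorphic_on lower_half)
    \<and> (\<forall>z\<in>lower_half. \<forall>u. summable (energy z (vblock_id (\<phi> z) *v u)))"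
  by (simp add: is_weyl_function_def summable_weyl_series_iff)

lemma is_weyl_function_iff_eq:
  assumes "is_weyl_function C \<psi>"
  shows "is_weyl_function C \<phi> \<longleftrightarrow> (\<forall>z\<in>lower_half. \<phi> z = \<psi> z)"
proof
  assume "is_weyl_function C \<phi>"
  with assms show "\<forall>z\<in>lower_half. \<phi> z = \<psi> z"
    by (auto simp: is_weyl_function_iff lower_half_def intro: weyl_matrix_unique)
next
  assume eq: "\<forall>z\<in>lower_half. \<phi> z = \<psi> z"
  then have "(\<lambda>z. \<phi> z $ a $ b) holomorphic_on lower_half
      \<longleftrightarrow> (\<lambda>z. \<psi> z $ a $ b) holomorphic_on lower_half" for a b
    by (intro holomorphic_cong) auto
  with assms eq show "is_weyl_function C \<phi>"
    by (simp add: is_weyl_function_iff)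
qed

end

section \<open>S-nodes and the Darboux matrix\<close>

text \<open>
  If \<open>x = (A - z)\<^sup>-\<^sup>1 P e\<close>, then \<open>darboux J S P e x\<close> is \<open>w(z) e\<close> for the Darboux matrix
  \<open>w(z) = I - i J P\<^sup>* S\<^sup>-\<^sup>1 (A - z)\<^sup>-\<^sup>1 P\<close>. Only the relation
  \<open>A x = z x + P e\<close> between \<open>e\<close> and \<open>x\<close> is used below, so that \<open>z\<close> may be an eigenvalue of \<open>A\<close>.
\<close>

definition darboux ::
    "complex^'m^'m \<Rightarrow> complex^'n^'n \<Rightarrow> complex^'m^'n \<Rightarrow> complex^'m \<Rightarrow> complex^'n \<Rightarrow> complex^'m" where
  "darboux J S P e x = e - \<i> *s (J *v (adj P *v (matrix_inv S *v x)))"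

locale s_node = signature_matrix J
  for J :: "complex^'m^'m" +
  fixes A S :: "complex^'n^'n" and P :: "complex^'m^'n"
  assumes S_pos: "pos_def S"
    and identity: "A ** S - S ** adj A = smul \<i> (P ** J ** adj P)"
begin

abbreviation T where "T \<equiv> matrix_inv S"
abbreviation R where "R x \<equiv> adj P *v (T *v x)"

lemma adj_S: "adj S = S"
  by (rule pos_def_adj[OF S_pos])

lemma adj_T: "adj T = T"
  by (rule pos_def_adj[OF pos_def_matrix_inv[OF S_pos]])

lemma S_T_mult_vec [simp]: "S *v (T *v x) = x" "T *v (S *v x) = x"
  by (simp_all add: matrix_inv_mult_vec pos_def_invertible[OF S_pos])

lemma P_J_adj_P_mult_vec:
  "P *v (J *v (adj P *v x)) = - \<i> *s (A *v (S *v x) - S *v (adj A *v x))"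
proof -
  have "\<i> *s (P *v (J *v (adj P *v x))) = A *v (S *v x) - S *v (adj A *v x)"
    using arg_cong[OF identity, of "\<lambda>M. M *v x"] by (simp add: matrix_vector_simps)
  from arg_cong[OF this, of "\<lambda>y. - \<i> *s y"] show ?thesis
    by (simp add: vector_smult_assoc)
qed

lemma quad_form_J_adj_P: "quad_form J (adj P *v x) = - 2 * (x \<bullet> (\<i> *s (A *v (S *v x))))"
proof -
  have "x \<bullet> (\<i> *s (S *v (adj A *v x))) = (\<i> *s x) \<bullet> (A *v (S *v x))"
    using inner_mult_vec_left[of A "S *v x" "\<i> *s x"] inner_mult_vec_left[of S x]
    by (simp add: adj_S vector_scalar_commute inner_commute)
  then have "x \<bullet> (\<i> *s (S *v (adj A *v x))) = - (x \<bullet> (\<i> *s (A *v (S *v x))))"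
    by (simp only: inner_ii_smult_right[of x "A *v (S *v x)"])
  moreover have "quad_form J (adj P *v x) = x \<bullet> (P *v (J *v (adj P *v x)))"
    by (simp add: quad_form_def inner_mult_vec_left)
  ultimately show ?thesis
    by (simp add: P_J_adj_P_mult_vec vector_ssub_ldistrib vector_smult_lneg inner_simps)
qed

lemma quad_form_darboux:
  assumes A_x: "A *v x = z *s x + P *v e"
  shows "quad_form J (darboux J S P e x) = quad_form J e + 2 * Im z * quad_form T x"
proof -
  let ?t = "T *v x"
  have "quad_form J (darboux J S P e x)
      = quad_form J e - 2 * (e \<bullet> (\<i> *s R x)) + quad_form J (R x)"
    by (simp add: darboux_def quad_form_diff adj_J vector_scalar_commute quad_form_smult)
      (simp add: quad_form_def inner_J)
  also have "e \<bullet> (\<i> *s R x) = - (?t \<bullet> (\<i> *s (P *v e)))"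
    using inner_mult_vec_left[of P e "\<i> *s ?t"] inner_ii_smult_right[of "P *v e" ?t]
    by (simp add: vector_scalar_commute inner_commute)
  also have "quad_form J (R x)
      = - 2 * (?t \<bullet> (\<i> *s (P *v e))) - 2 * (?t \<bullet> ((\<i> * z) *s x))"
    by (simp add: quad_form_J_adj_P A_x vector_add_ldistrib vector_smult_assoc inner_simps)
  also have "?t \<bullet> ((\<i> * z) *s x) = - Im z * quad_form T x"
    using inner_smult_hermitian[OF adj_S, of ?t "\<i> * z"]
    by (simp add: quad_form_def inner_commute)
  finally show ?thesis by simp
qed

lemma quad_form_darboux_le:
  assumes "A *v x = z *s x + P *v e" and "Im z \<le> 0"
  shows "quad_form J (darboux J S P e x) \<le> quad_form J e"
  using quad_form_darboux[OF assms(1)] assms(2) quad_form_nonneg[OF pos_def_matrix_inv[OF S_pos]]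
  by (simp add: mult_nonpos_nonneg)

end

locale s_node_step = s_node J A S P
  for J :: "complex^'m^'m" and A S :: "complex^'n^'n" and P :: "complex^'m^'n" +
  fixes S' :: "complex^'n^'n" and P' :: "complex^'m^'n"
  assumes invertible_A: "invertible A"
    and P'_eq: "P' = P + smul \<i> (matrix_inv A ** P ** J)"
    and S'_eq: "S' = S + matrix_inv A ** S ** matrix_inv (adj A)
      + matrix_inv A ** P ** adj P ** matrix_inv (adj A)"
begin

abbreviation B where "B \<equiv> matrix_inv A"

lemma matrix_inv_adj_A: "matrix_inv (adj A) = adj B"
  by (rule adj_matrix_inv[OF invertible_A])

lemma A_B_mult_vec [simp]: "A *v (B *v x) = x" "B *v (A *v x) = x"
  by (simp_all add: matrix_inv_mult_vec[OF invertible_A])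

lemma adj_A_adj_B_mult_vec [simp]:
  "adj A *v (adj B *v x) = x" "adj B *v (adj A *v x) = x"
  by (simp_all add: matrix_vector_mul_assoc matrix_inv_mult[OF invertible_A] flip: adj_mult)

lemma P'_mult_vec: "P' *v x = P *v x + \<i> *s (B *v (P *v (J *v x)))"
  by (simp add: P'_eq matrix_vector_simps)

lemma adj_P'_mult_vec: "adj P' *v x = adj P *v x - \<i> *s (J *v (adj P *v (adj B *v x)))"
  by (simp add: P'_eq matrix_vector_simps adj_add adj_smul adj_mult adj_J vector_smult_lneg)

lemma S'_mult_vec:
  "S' *v x = S *v x + B *v (S *v (adj B *v x)) + B *v (P *v (adj P *v (adj B *v x)))"
  by (simp add: S'_eq matrix_vector_simps matrix_inv_adj_A)

lemma quad_form_S':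
  "quad_form S' x = quad_form S x + quad_form S (adj B *v x)
    + (adj P *v (adj B *v x)) \<bullet> (adj P *v (adj B *v x))"
  by (simp add: quad_form_def S'_mult_vec inner_simps inner_mult_vec_left)

lemma S'_pos: "pos_def S'"
  unfolding pos_def_iff
proof (intro conjI allI impI)
  show "adj S' = S'"
    by (simp add: S'_eq matrix_inv_adj_A adj_add adj_mult adj_S matrix_mul_assoc)
  show "0 < quad_form S' x" if "x \<noteq> 0" for x
    unfolding quad_form_S' using quad_form_pos[OF S_pos that] quad_form_nonneg[OF S_pos]
    by (intro add_pos_nonneg inner_ge_zero)
qed

lemma S'_identity: "A ** S' - S' ** adj A = smul \<i> (P' ** J ** adj P')"
  by (simp add: matrix_eq matrix_vector_simps S'_mult_vec P'_mult_vec adj_P'_mult_vec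
      P_J_adj_P_mult_vec vec_eq_iff algebra_simps)

sublocale succ: s_node J A S' P'
  by unfold_locales (fact S'_pos S'_identity)+

lemma P'_J_adj_P_mult_vec:
  "P' *v (J *v (adj P *v x)) = - \<i> *s (A *v (S *v x) + B *v (S *v x) - S' *v (adj A *v x))"
  by (simp add: matrix_vector_simps S'_mult_vec P'_mult_vec P_J_adj_P_mult_vec vec_eq_iff
      algebra_simps)

lemma P_J_adj_P'_mult_vec:
  "P *v (J *v (adj P' *v x)) = \<i> *s (S *v (adj A *v x + adj B *v x) - A *v (S' *v x))"
  by (simp add: matrix_vector_simps S'_mult_vec adj_P'_mult_vec P_J_adj_P_mult_vec vec_eq_iff
      algebra_simps)

definition potential :: "complex^'m^'m" where
  "potential = mat 1 + adj P ** T ** P - adj P' ** succ.T ** P'"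

lemma potential_mult_vec: "potential *v x = x + R (P *v x) - succ.R (P' *v x)"
  by (simp add: potential_def matrix_vector_simps)

lemma adj_potential: "adj potential = potential"
  by (simp add: potential_def adj_add adj_diff adj_mult adj_T succ.adj_T matrix_mul_assoc)

lemma potential_J_R:
  "potential *v (J *v R x) = \<i> *s succ.R (A *v x + B *v x) - \<i> *s R (A *v x)"
  by (simp add: potential_mult_vec matrix_vector_simps P'_J_adj_P_mult_vec P_J_adj_P_mult_vec
      adj_P'_mult_vec vec_eq_iff algebra_simps)

lemma potential_J_succ_R:
  "potential *v (J *v succ.R x) = \<i> *s succ.R (A *v x) - \<i> *s R (A *v x)"
  unfolding potential_mult_vec P_J_adj_P'_mult_vec succ.P_J_adj_P_mult_vec
  by (simp add: matrix_vector_simps adj_P'_mult_vec vec_eq_iff algebra_simps)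

lemma potential_J_potential: "potential ** J ** potential = J"
  unfolding matrix_eq
proof
  fix x
  have A_P': "A *v (P' *v x) = A *v (P *v x) + \<i> *s (P *v (J *v x))"
    by (simp add: P'_mult_vec matrix_vector_simps)
  have "potential *v (J *v (potential *v x)) = potential *v (J *v x)
      + potential *v (J *v R (P *v x)) - potential *v (J *v succ.R (P' *v x))"
    by (simp add: potential_mult_vec[of x] matrix_vector_simps)
  also have "\<dots> = J *v x + R (P *v (J *v x)) - succ.R (P' *v (J *v x))
      + (\<i> *s succ.R (A *v (P *v x) + B *v (P *v x)) - \<i> *s R (A *v (P *v x)))
      - (\<i> *s succ.R (A *v (P' *v x)) - \<i> *s R (A *v (P' *v x)))"
    unfolding potential_J_R potential_J_succ_R unfolding potential_mult_vec ..
  also have "\<dots> = J *v x"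
    by (simp add: A_P') (simp add: P'_mult_vec matrix_vector_simps vec_eq_iff algebra_simps)
  finally show "potential ** J ** potential *v x = J *v x"
    by (simp flip: matrix_vector_mul_assoc)
qed

text \<open>
  With \<open>y = S'\<^sup>-\<^sup>1 P' v\<close> one has \<open>v\<^sup>* P'\<^sup>* S'\<^sup>-\<^sup>1 P' v = 2 y\<^sup>* P' v - y\<^sup>* S' y\<close>; inserting the recursion
  for \<open>P'\<close> and \<open>S'\<close> leaves complete squares.
\<close>

lemma quad_form_potential:
  fixes v :: "complex^'m"
  defines "y \<equiv> succ.T *v (P' *v v)"
  defines "w \<equiv> adj B *v y"
  defines "u \<equiv> adj P *v w - \<i> *s (J *v v)"
  shows "quad_form potential v = quad_form S (y - T *v (P *v v)) + u \<bullet> u + quad_form S w"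
proof -
  let ?cross = "w \<bullet> (\<i> *s (P *v (J *v v)))"
  have potential_form: "quad_form potential v = v \<bullet> v + quad_form T (P *v v) - (P' *v v) \<bullet> y"
    by (simp add: quad_form_def potential_mult_vec inner_simps inner_mult_vec_left y_def)
  have "(P' *v v) \<bullet> y = quad_form S' y"
    by (simp add: quad_form_def y_def inner_commute)
  then have S'_expansion: "(P' *v v) \<bullet> y = quad_form S y + quad_form S w + (adj P *v w) \<bullet> (adj P *v w)"
    by (simp add: quad_form_S' w_def)
  have P'_expansion: "(P' *v v) \<bullet> y = y \<bullet> (P *v v) + ?cross"
    by (simp add: P'_mult_vec inner_simps inner_mult_vec_left w_def vector_scalar_commute
        inner_commute[of _ y])
  have S_square: "quad_form S (y - T *v (P *v v))
      = quad_form S y - 2 * (y \<bullet> (P *v v)) + quad_form T (P *v v)"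
    by (simp add: quad_form_diff adj_S) (simp add: quad_form_def inner_commute)
  have "(adj P *v w) \<bullet> (\<i> *s (J *v v)) = ?cross"
    by (simp add: inner_mult_vec_left vector_scalar_commute)
  moreover have "(\<i> *s (J *v v)) \<bullet> (\<i> *s (J *v v)) = v \<bullet> v"
    by (simp add: inner_smult_left vector_smult_assoc inner_J)
  ultimately have u_square: "u \<bullet> u = (adj P *v w) \<bullet> (adj P *v w) - 2 * ?cross + v \<bullet> v"
    by (simp add: u_def inner_simps inner_commute)
  show ?thesis
    using potential_form S'_expansion P'_expansion S_square u_square by simp
qed

lemma potential_pos: "pos_def potential"
  unfolding pos_def_iff
proof (intro conjI allI impI)
  show "adj potential = potential" by (rule adj_potential)
  fix v :: "complex^'m" assume "v \<noteq> 0"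
  define w where "w = adj B *v (succ.T *v (P' *v v))"
  define u where "u = adj P *v w - \<i> *s (J *v v)"
  have "u \<noteq> 0" if "w = 0"
    using \<open>v \<noteq> 0\<close> that by (simp add: u_def J_mult_vec_eq_0_iff)
  then have "0 < u \<bullet> u + quad_form S w"
    using quad_form_pos[OF S_pos, of w] quad_form_nonneg[OF S_pos, of w]
    by (cases "w = 0") (auto intro: add_pos_nonneg add_nonneg_pos)
  then show "0 < quad_form potential v"
    unfolding quad_form_potential u_def w_def
    using quad_form_nonneg[OF S_pos, of "succ.T *v (P' *v v) - T *v (P *v v)"] by linarith
qed

lemma P'_mult_negative_vec:
  assumes "J *v e = - e"
  shows "P' *v e = P *v e - \<i> *s (B *v (P *v e))"
  by (simp add: P'_mult_vec assms linear_neg[OF matrix_vector_mul_linear] vector_smult_rneg)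

lemma resolvent_vec_step:
  assumes "J *v e = - e" "A *v x = z *s x + P *v e"
  defines "x' \<equiv> x - \<i> *s (B *v x)"
  shows "A *v x' = z *s x' + P' *v e"
proof -
  have P_e: "P *v e = A *v x - z *s x" using assms(2) by simp
  show ?thesis
    unfolding x'_def P'_mult_negative_vec[OF assms(1)] P_e
    by (simp add: matrix_vector_simps vec_eq_iff algebra_simps)
qed

lemma potential_mult_darboux:
  assumes "J *v e = - e" "A *v x = z *s x + P *v e"
  defines "x' \<equiv> x - \<i> *s (B *v x)"
  shows "potential *v darboux J S P e x = e - z *s R x + (z + \<i>) *s succ.R x'"
proof -
  have P_e: "P *v e = A *v x - z *s x" using assms(2) by simp
  have P'_e: "P' *v e = A *v x' - z *s x'"
    using resolvent_vec_step[OF assms(1,2)] by (simp add: x'_def)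
  show ?thesis
    unfolding darboux_def matrix_vector_mult_diff_distrib vector_scalar_commute
      potential_J_R potential_mult_vec[of e] P_e P'_e
    by (simp add: x'_def matrix_vector_simps vec_eq_iff algebra_simps)
qed

lemma darboux_step:
  assumes "J *v e = - e" "A *v x = z *s x + P *v e" and "z \<noteq> 0"
  shows "darboux J S P e x - (\<i> / z) *s (J *v (potential *v darboux J S P e x))
    = (1 + \<i> / z) *s darboux J S' P' e (x - \<i> *s (B *v x))"
  unfolding potential_mult_darboux[OF assms(1,2)]
  by (simp add: darboux_def matrix_vector_simps assms(1) vec_eq_iff)
    (use \<open>z \<noteq> 0\<close> in \<open>simp add: field_simps\<close>)

end

section \<open>Explicit solutions\<close>

locale explicit_dirac_system =
  fixes A S0 :: "complex^'n^'n" and P0 :: "complex^('p::finite + 'p)^'n"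
  assumes invertible_A: "invertible A"
    and S0_pos: "pos_def S0"
    and S0_identity: "A ** S0 - S0 ** adj A = smul \<i> (P0 ** jmat ** adj P0)"
begin

abbreviation P where "P \<equiv> PiSeq A P0"
abbreviation S where "S \<equiv> SSeq A S0 P0"
abbreviation C where "C \<equiv> CSeq A S0 P0"

lemma s_node_step: "s_node_step jmat A (S k) (P k) (S (Suc k)) (P (Suc k))"
proof (induction k)
  case 0
  show ?case
    using invertible_A S0_pos S0_identity by unfold_locales simp_all
next
  case (Suc k)
  then interpret s_node_step jmat A "S k" "P k" "S (Suc k)" "P (Suc k)" .
  show ?case
    using invertible_A S'_pos S'_identity by unfold_locales simp_all
qed

lemma s_node: "s_node jmat A (S k) (P k)"
  using s_node_step s_node_step.axioms(1) by blast

lemma S_pos: "pos_def (S k)"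
  by (rule s_node.S_pos[OF s_node])

lemma CSeq_eq_potential: "C k = s_node_step.potential (S k) (P k) (S (Suc k)) (P (Suc k))"
  unfolding CSeq_def s_node_step.potential_def[OF s_node_step] ..

sublocale dirac_system C
  using s_node_step.potential_pos[OF s_node_step] s_node_step.potential_J_potential[OF s_node_step]
  by unfold_locales (simp_all only: CSeq_eq_potential)

lemma Wsol_darboux:
  assumes z_nonzero: "z \<noteq> 0" and e_negative: "jmat *v e = - e" and initial: "A *v x = z *s x + P0 *v e"
  shows "\<exists>x'. A *v x' = z *s x' + P k *v e \<and>
    Wsol C z k *v darboux jmat S0 P0 e x = (1 + \<i> / z) ^ k *s darboux jmat (S k) (P k) e x'"
proof (induction k)
  case 0
  show ?case using initial by auto
next
  case (Suc k)
  interpret s_node_step jmat A "S k" "P k" "S (Suc k)" "P (Suc k)" by (rule s_node_step)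
  let ?D = "darboux jmat (S k) (P k) e"
  let ?D' = "darboux jmat (S (Suc k)) (P (Suc k)) e"
  obtain y where state: "A *v y = z *s y + P k *v e"
    and Wsol_k: "Wsol C z k *v darboux jmat S0 P0 e x = (1 + \<i> / z) ^ k *s ?D y"
    using Suc by blast
  let ?y' = "y - \<i> *s (matrix_inv A *v y)"
  have "Wsol C z (Suc k) *v darboux jmat S0 P0 e x
      = (1 + \<i> / z) ^ k *s (?D y - (\<i> / z) *s (jmat *v (C k *v ?D y)))"
    by (simp only: Wsol.simps matrix_vector_simps Wsol_k vector_ssub_ldistrib
        vector_smult_assoc mult.commute)
  also have "\<dots> = (1 + \<i> / z) ^ k *s ((1 + \<i> / z) *s ?D' ?y')"
    by (simp only: CSeq_eq_potential darboux_step[OF e_negative state z_nonzero])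
  also have "\<dots> = (1 + \<i> / z) ^ Suc k *s ?D' ?y'"
    by (simp only: vector_smult_assoc power_Suc mult.commute)
  finally show ?case using resolvent_vec_step[OF e_negative state] by blast
qed

lemma summable_energy_darboux:
  assumes Im_z_neg: "Im z < 0" and e_negative: "jmat *v e = - e" and initial: "A *v x = z *s x + P0 *v e"
  shows "summable (energy z (darboux jmat S0 P0 e x))"
proof (rule summable_energy_if_bounded[OF Im_z_neg])
  fix k
  have "z \<noteq> 0" using Im_z_neg by auto
  then obtain x' where state: "A *v x' = z *s x' + P k *v e"
    and Wsol_k: "Wsol C z k *v darboux jmat S0 P0 e x
      = (1 + \<i> / z) ^ k *s darboux jmat (S k) (P k) e x'"
    using Wsol_darboux[OF _ e_negative initial] by blast
  have "quad_form jmat (darboux jmat (S k) (P k) e x') \<le> quad_form jmat e"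
    using s_node.quad_form_darboux_le[OF s_node state] Im_z_neg by simp
  also have "quad_form jmat e \<le> 0"
    by (simp add: quad_form_def e_negative)
  finally show "j_energy z (darboux jmat S0 P0 e x) k \<le> 0"
    by (simp only: j_energy_def Wsol_k quad_form_smult)
      (simp add: mult_nonneg_nonpos qfun_nonneg)
qed

end

locale explicit_dirac_system_blocks = explicit_dirac_system A S0 "hblock Phi Psi"
  for A S0 :: "complex^'n^'n" and Phi Psi :: "complex^'p::finite^'n"
begin

abbreviation T0 where "T0 \<equiv> matrix_inv S0"

abbreviation pencil where "pencil z \<equiv> A + smul \<i> (Psi ** adj Psi ** T0) - smul z (mat 1)"

definition weyl :: "complex \<Rightarrow> complex^'p^'p" where
  "weyl z = smul (-\<i>) (adj Phi ** T0 ** matrix_inv (pencil z) ** Psi)"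

lemma darboux_initial:
  assumes "pencil z *v x = Psi *v u"
  defines "e \<equiv> vpair 0 (u - \<i> *s (adj Psi *v (T0 *v x)))"
  shows "jmat *v e = - e"
    and "A *v x = z *s x + hblock Phi Psi *v e"
    and "darboux jmat S0 (hblock Phi Psi) e x = vpair (-\<i> *s (adj Phi *v (T0 *v x))) u"
proof -
  show "jmat *v e = - e"
    by (simp add: e_def jmat_mult_vpair vec_eq_iff_Plus)
  show "A *v x = z *s x + hblock Phi Psi *v e"
    using assms(1)
    by (simp add: e_def hblock_mult_vpair matrix_vector_simps vec_eq_iff algebra_simps)
  show "darboux jmat S0 (hblock Phi Psi) e x = vpair (-\<i> *s (adj Phi *v (T0 *v x))) u"
    by (simp add: darboux_def e_def adj_hblock_mult_vec jmat_mult_vpair vec_eq_iff_Plus)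
qed

lemma invertible_pencil:
  assumes Im_z_neg: "Im z < 0"
  shows "invertible (pencil z)"
proof (rule invertibleI_ker, rule ccontr)
  fix x assume "pencil z *v x = 0" and "x \<noteq> 0"
  then have ker: "pencil z *v x = Psi *v 0" by simp
  define e where "e = vpair 0 (0 - \<i> *s (adj Psi *v (T0 *v x)))"
  note initial = darboux_initial[OF ker, folded e_def]
  have "quad_form jmat (darboux jmat S0 (hblock Phi Psi) e x)
      = quad_form jmat e + 2 * Im z * quad_form T0 x"
    using s_node.quad_form_darboux[OF s_node[of 0]] initial(2) by simp
  moreover have "0 \<le> quad_form jmat (darboux jmat S0 (hblock Phi Psi) e x)"
    by (simp add: initial(3) quad_form_jmat_vpair)
  moreover have "quad_form jmat e \<le> 0"
    by (simp add: quad_form_def initial(1))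
  moreover have "2 * Im z * quad_form T0 x < 0"
    using Im_z_neg quad_form_pos[OF pos_def_matrix_inv[OF S0_pos] \<open>x \<noteq> 0\<close>]
    by (simp add: mult_neg_pos)
  ultimately show False by linarith
qed

lemma summable_energy_weyl:
  assumes Im_z_neg: "Im z < 0"
  shows "summable (energy z (vblock_id (weyl z) *v u))"
proof -
  define x where "x = matrix_inv (pencil z) *v (Psi *v u)"
  have pencil_x: "pencil z *v x = Psi *v u"
    unfolding x_def by (rule matrix_inv_mult_vec(1)[OF invertible_pencil[OF Im_z_neg]])
  have "vblock_id (weyl z) *v u = vpair (-\<i> *s (adj Phi *v (T0 *v x))) u"
    by (simp add: vblock_id_mult_vec weyl_def x_def smul_mult_vec flip: matrix_vector_mul_assoc)
  then show ?thesis
    using summable_energy_darboux[OF Im_z_neg darboux_initial(1,2)[OF pencil_x]]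
    by (simp only: darboux_initial(3)[OF pencil_x])
qed

lemma holomorphic_on_weyl: "(\<lambda>z. weyl z $ a $ b) holomorphic_on lower_half"
proof -
  have "(\<lambda>z. pencil z $ i $ j) holomorphic_on lower_half" for i j
    by (simp add: smul_def) (intro holomorphic_intros)
  then have "(\<lambda>z. matrix_inv (pencil z) $ i $ j) holomorphic_on lower_half" for i j
    by (rule holomorphic_on_matrix_inv) (simp add: invertible_pencil lower_half_def)
  then have "(\<lambda>z. (adj Phi ** T0 ** matrix_inv (pencil z) ** Psi) $ a $ b)
      holomorphic_on lower_half"
    by (intro holomorphic_on_matrix_mult holomorphic_on_const)
  then show ?thesis
    unfolding weyl_def smul_def by (simp, intro holomorphic_intros)
qed

lemma is_weyl_function_weyl: "is_weyl_function C weyl"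
  using holomorphic_on_weyl summable_energy_weyl
  unfolding is_weyl_function_iff lower_half_def by blast

end

theorem theorem4p2:
  fixes A S0 :: "complex^'n^'n"
    and Phi Psi :: "complex^'p^'n"
  assumes detA: "det A \<noteq> 0"
    and S0pos: "pos_def S0"
    and identity: "A ** S0 - S0 ** adj A = smul \<i> (hblock Phi Psi ** jmat ** adj (hblock Phi Psi))"
  shows "(\<forall>k. invertible (SSeq A S0 (hblock Phi Psi) k)
              \<and> pos_def (CSeq A S0 (hblock Phi Psi) k)
              \<and> CSeq A S0 (hblock Phi Psi) k ** jmat ** CSeq A S0 (hblock Phi Psi) k = jmat)
       \<and> (\<forall>z\<in>lower_half. invertible (A + smul \<i> (Psi ** adj Psi ** matrix_inv S0) - smul z (mat 1)))
       \<and> (\<forall>\<phi>. is_weyl_function (CSeq A S0 (hblock Phi Psi)) \<phi> \<longleftrightarrow>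
              (\<forall>z\<in>lower_half. \<phi> z = smul (-\<i>) (adj Phi ** matrix_inv S0
                  ** matrix_inv (A + smul \<i> (Psi ** adj Psi ** matrix_inv S0) - smul z (mat 1)) ** Psi)))"
proof -
  interpret explicit_dirac_system_blocks A S0 Phi Psi
    using assms by unfold_locales (simp_all add: invertible_det_nz)
  show ?thesis
    using pos_def_invertible[OF S_pos] C_pos C_jmat_C invertible_pencil
      is_weyl_function_iff_eq[OF is_weyl_function_weyl]
    by (simp add: lower_half_def weyl_def)
qed

end
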